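(* Let $U_1,U_2,\dots$ be i.i.d. uniform random variables on $[0,1]$, and let $T$ be the number of samples taken until three consecutive increasing values are obtained, i.e. the least $t\ge 3$ with $U_{t-2}<U_{t-1}<U_t$. Then the probability generating function $P(x)=\sum_{r\ge 0}\Pr(T=r)\,x^r$ is \[P(x) = 1 + \frac{\sqrt3}{2}\,e^{x/2}\,(x-1)\sec\left(\frac{\pi}{6} + x\frac{\sqrt3}{2}\right)\] (i.e. $\Pr(T=r)$ is the coefficient of $x^r$ in the power series expansion of the right-hand side at $x=0$). *)

theory Defs
  imports "HOL-Probability.Probability" "HOL-Analysis.FPS_Convergence"
begin

text \<open>
  The samples are \<open>U 1, U 2, \<dots>\<close>; the value \<open>U 0\<close> plays no role. The waiting time takes values
  in \<^typ>\<open>enat\<close> and is \<open>\<infinity>\<close> (the infimum of the empty set) on the outcomes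
  where three consecutive increasing values never occur.
\<close>

definition waiting_time :: "(nat \<Rightarrow> 'a \<Rightarrow> real) \<Rightarrow> 'a \<Rightarrow> enat" where
  "waiting_time U \<omega> =
     Inf (enat ` {t. t \<ge> 3 \<and> U (t - 2) \<omega> < U (t - 1) \<omega> \<and> U (t - 1) \<omega> < U t \<omega>})"

definition prob_eq :: "'a measure \<Rightarrow> ('a \<Rightarrow> enat) \<Rightarrow> nat \<Rightarrow> real" where
  "prob_eq M T r = measure M {\<omega> \<in> space M. T \<omega> = enat r}"

text \<open>The series converges absolutely for \<open>\<bar>x\<bar> \<le> 1\<close>.\<close>

definition pgf :: "'a measure \<Rightarrow> ('a \<Rightarrow> enat) \<Rightarrow> real \<Rightarrow> real" where
  "pgf M T x = (\<Sum>r. prob_eq M T r * x ^ r)"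

definition sec :: "real \<Rightarrow> real" where
  "sec x = 1 / cos x"

end

theory Submission
  imports Defs
begin

text \<open>
  Let \<open>g n\<close> be the probability that \<open>U 1, \<dots>, U n\<close> contain no three consecutive increasing values
  (no \<^emph>\<open>double rise\<close>). Since \<open>T = r\<close> exactly when a double rise occurs among the first \<open>r\<close> samples
  but not among the first \<open>r - 1\<close>, we have \<open>Pr(T = r) = g (r - 1) - g r\<close>, so that
  \<open>P(x) = 1 + (x - 1) G(x)\<close> with \<open>G(x) = \<Sum>n. g n x\<^sup>n\<close>.

  The function \<open>G\<close> is found by describing its reciprocal. For \<open>m \<le> n\<close> consider the event that the
  first \<open>m\<close> samples contain no double rise and the remaining \<open>n - m\<close> are increasing. By independence
  its probability is \<open>g m / (n - m)!\<close> (\<open>prob_rises_after\<close>). On a given outcome with \<open>n \<ge> 1\<close>, let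
  the maximal final increasing run consist of the samples after position \<open>s\<close>. If the event holds for
  some \<open>m\<close>, it holds precisely for \<open>m = s, s + 1, s + 2\<close> (as far as these are at most \<open>n\<close>): a smaller
  \<open>m\<close> leaves a rest that is not increasing, a larger one puts three terms of the run into the prefix.
  Attach to the event the weight \<open>1, - 1, 0, 1, - 1, 0, \<dots>\<close> according to \<open>n - m\<close>. Any three
  consecutive weights add up to \<open>0\<close>, and so do the first two, hence the weighted count of events vanishes
  on every outcome (\<open>final_run_cancellation\<close>). Taking expectations gives
  \<open>\<Sum>m\<le>n. g m w (n - m) / (n - m)! = 0\<close> for \<open>n \<ge> 1\<close>, where \<open>w\<close> denotes the weights; that is,
  \<open>G(x) \<cdot> (\<Sum>j. w j x\<^sup>j / j!) = 1\<close>.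

  The weights have period three and mean zero, so they are the real part of a multiple of the powers of a
  primitive cube root of unity \<open>\<zeta>\<close>. The second factor is therefore the real part of a multiple of
  \<open>exp (\<zeta> x)\<close>, which is \<open>2 / \<surd>3 \<cdot> exp (- x / 2) \<cdot> cos (\<pi> / 6 + x \<surd>3 / 2)\<close> (\<open>run_weight_exp_sums\<close>).

  The product of series makes sense for \<open>\<bar>x\<bar> < 1\<close>, where \<open>G\<close> converges because \<open>g\<close> is bounded by \<open>1\<close>.
  This already determines the power series; the points \<open>x = 1\<close> and \<open>x = - 1\<close> follow by continuity, as
  \<open>\<Sum>r. Pr(T = r)\<close> converges and the cosine has no zero on \<open>[- 1, 1]\<close>.
\<close>

section \<open>Double rises and final runs of a deterministic sequence\<close>

definition no_double_rise :: "(nat \<Rightarrow> real) \<Rightarrow> nat \<Rightarrow> bool" where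
  "no_double_rise u n \<longleftrightarrow> (\<forall>t\<in>{3..n}. \<not> (u (t - 2) < u (t - 1) \<and> u (t - 1) < u t))"

definition rises_after :: "nat \<Rightarrow> (nat \<Rightarrow> real) \<Rightarrow> nat \<Rightarrow> bool" where
  "rises_after m u n \<longleftrightarrow> no_double_rise u m \<and> strict_mono_on {m<..n} u"

definition run_weight :: "nat \<Rightarrow> real" where
  "run_weight j = (if j mod 3 = 0 then 1 else if j mod 3 = 1 then - 1 else 0)"

lemma run_weight_0 [simp]: "run_weight 0 = 1" and run_weight_1 [simp]: "run_weight (Suc 0) = - 1"
  by (simp_all add: run_weight_def)

lemma run_weight_rec: "run_weight j + run_weight (Suc j) + run_weight (Suc (Suc j)) = 0"
proof -
  consider "j mod 3 = 0" | "j mod 3 = 1" | "j mod 3 = 2" by linarith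
  then show ?thesis
    by cases (simp_all add: run_weight_def mod_Suc)
qed

lemma abs_run_weight_le: "\<bar>run_weight j\<bar> \<le> 1"
  by (simp add: run_weight_def)

lemma rises_after_refl: "rises_after m u m \<longleftrightarrow> no_double_rise u m"
  by (simp add: rises_after_def monotone_on_def)

lemma rises_after_Suc:
  assumes "m \<le> n"
  shows "rises_after m u (Suc n) \<longleftrightarrow> rises_after m u n \<and> (\<forall>i\<in>{m<..n}. u i < u (Suc n))"
proof -
  have "{m<..Suc n} = insert (Suc n) {m<..n}" using assms by auto
  then show ?thesis
    unfolding rises_after_def monotone_on_def by auto
qed

text \<open>
  The position \<open>s\<close> after which the maximal final increasing run begins. Maximality gives a
  non-rise at \<open>s\<close>, unless the run is the whole sequence.
\<close>

lemma final_run: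
  fixes u :: "nat \<Rightarrow> 'a::preorder"
  assumes "n \<ge> 1"
  obtains s where "s < n" "\<And>m. m \<le> n \<Longrightarrow> strict_mono_on {m<..n} u \<longleftrightarrow> s \<le> m"
    "s > 0 \<Longrightarrow> \<not> u s < u (Suc s)"
proof -
  let ?R = "\<lambda>m. strict_mono_on {m<..n} u"
  define s where "s = (LEAST m. ?R m)"
  have "{n - 1<..n} = {n}" using assms by auto
  then have "?R (n - 1)" by (simp add: monotone_on_def)
  then have "?R s" "s \<le> n - 1" unfolding s_def by (rule LeastI, rule Least_le)
  show ?thesis
  proof
    show "s < n" using \<open>s \<le> n - 1\<close> assms by simp
    show "?R m \<longleftrightarrow> s \<le> m" for m
    proof
      assume "?R m" then show "s \<le> m" unfolding s_def by (rule Least_le)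
    next
      assume "s \<le> m"
      then have "{m<..n} \<subseteq> {s<..n}" by auto
      with \<open>?R s\<close> show "?R m" by (rule monotone_on_subset)
    qed
    show "\<not> u s < u (Suc s)" if "s > 0"
    proof
      assume step: "u s < u (Suc s)"
      have "?R (s - 1)"
      proof (rule strict_mono_onI)
        fix i j assume ij: "i \<in> {s - 1<..n}" "j \<in> {s - 1<..n}" "i < j"
        show "u i < u j"
        proof (cases "i = s")
          case True
          have "u (Suc s) \<le> u j"
          proof (cases "j = Suc s")
            case False
            then have "u (Suc s) < u j"
              using ij True by (intro strict_mono_onD[OF \<open>?R s\<close>]) auto
            then show ?thesis by (rule less_imp_le)
          qed simp
          with step True show ?thesis by (auto intro: less_le_trans)
        next
          case False
          then show ?thesis using ij by (intro strict_mono_onD[OF \<open>?R s\<close>]) auto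
        qed
      qed
      then have "s \<le> s - 1" unfolding s_def by (rule Least_le)
      with that show False by simp
    qed
  qed
qed

text \<open>
  The summand is nonzero only for the at most three values of \<open>m\<close> that cut the sequence no earlier than the
  beginning of its final run and leave at most two terms of that run in the prefix; the weights at
  these cuts cancel. Ties between values do no harm, because a tie ends a run.
\<close>

lemma final_run_cancellation:
  assumes "n \<ge> 1"
  shows "(\<Sum>m\<le>n. run_weight (n - m) * of_bool (rises_after m u n)) = 0"
proof -
  obtain s where s: "s < n" "\<And>m. m \<le> n \<Longrightarrow> strict_mono_on {m<..n} u \<longleftrightarrow> s \<le> m"
      and brk: "s > 0 \<Longrightarrow> \<not> u s < u (Suc s)"
    using final_run[OF assms] by blast
  have mono: "strict_mono_on {s<..n} u" using s by simp
  \<comment> \<open>Two terms of the run create no double rise, since the preceding step is not a rise; three do.\<close>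
  have good: "no_double_rise u m \<longleftrightarrow> no_double_rise u s \<and> m \<le> s + 2" if m: "s \<le> m" "m \<le> n" for m
  proof
    assume G: "no_double_rise u m"
    have "m \<le> s + 2"
    proof (rule ccontr)
      assume "\<not> m \<le> s + 2"
      then have "u (s + 1) < u (s + 2)" "u (s + 2) < u (s + 3)" "s + 3 \<in> {3..m}"
        using m by (auto intro!: strict_mono_onD[OF mono])
      then show False
        using bspec[OF G[unfolded no_double_rise_def], of "s + 3"] by simp
    qed
    then show "no_double_rise u s \<and> m \<le> s + 2"
      using G m by (auto simp: no_double_rise_def)
  next
    assume *: "no_double_rise u s \<and> m \<le> s + 2"
    show "no_double_rise u m"
      unfolding no_double_rise_def
    proof
      fix t assume t: "t \<in> {3..m}"
      consider "t \<le> s" | "t = s + 1" | "t = s + 2" using t * by force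
      then show "\<not> (u (t - 2) < u (t - 1) \<and> u (t - 1) < u t)"
      proof cases
        case 1
        then show ?thesis using * t by (auto simp: no_double_rise_def)
      qed (use brk t in \<open>simp_all\<close>)
    qed
  qed
  have eq: "rises_after m u n \<longleftrightarrow> no_double_rise u s \<and> s \<le> m \<and> m \<le> s + 2" if "m \<le> n" for m
    using good s(2) that by (auto simp: rises_after_def)
  show ?thesis
  proof (cases "no_double_rise u s")
    case False
    then show ?thesis by (intro sum.neutral) (auto simp: eq)
  next
    case True
    have "(\<Sum>m\<le>n. run_weight (n - m) * of_bool (rises_after m u n)) =
          (\<Sum>m\<in>{s..min n (s + 2)}. run_weight (n - m))"
      using True by (intro sum.mono_neutral_cong_right) (auto simp: eq)
    also have "\<dots> = 0"
    proof (cases "n = s + 1")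
      case True
      then have "{s..min n (s + 2)} = {s, s + 1}" by auto
      then show ?thesis using True by simp
    next
      case False
      then obtain d where d: "n = s + 2 + d"
        using s(1) by (metis Suc_eq_plus1 Suc_leI add_2_eq_Suc' le_Suc_ex le_neq_implies_less)
      then have "{s..min n (s + 2)} = {s, s + 1, s + 2}" by auto
      then show ?thesis using d run_weight_rec[of d] by (simp add: Suc_diff_le)
    qed
    finally show ?thesis .
  qed
qed

section \<open>The probability of a final run\<close>

text \<open>
  The upper bound \<open>y\<close> on the run makes the event amenable to recursion: appending one more sample
  to the run means bounding the run by the value of that sample.
\<close>

definition below_run :: "nat \<Rightarrow> nat \<Rightarrow> real \<Rightarrow> (nat \<Rightarrow> real) \<Rightarrow> bool" where
  "below_run m n y u \<longleftrightarrow> rises_after m u n \<and> (\<forall>i\<in>{m<..n}. u i < y)"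

lemma pred_rises_after:
  assumes m: "m \<le> n" and X: "\<And>i. i \<in> {1..n} \<Longrightarrow> (\<lambda>x. X x i) \<in> borel_measurable N"
  shows "Measurable.pred N (\<lambda>x. rises_after m (X x) n)"
proof -
  have less: "Measurable.pred N (\<lambda>x. f x < g x)"
    if "f \<in> borel_measurable N" "g \<in> borel_measurable N" for f g :: "_ \<Rightarrow> real"
    using that by measurable
  show ?thesis
    unfolding rises_after_def no_double_rise_def monotone_on_def
    using m
    by (intro pred_intros_logic pred_intros_finite less X) auto
qed

lemma pred_below_run:
  assumes m: "m \<le> n" and X: "\<And>i. i \<in> {1..n} \<Longrightarrow> (\<lambda>x. X x i) \<in> borel_measurable N"
    and Y: "Y \<in> borel_measurable N"
  shows "Measurable.pred N (\<lambda>x. below_run m n (Y x) (X x))"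
proof -
  have less: "Measurable.pred N (\<lambda>x. f x < g x)"
    if "f \<in> borel_measurable N" "g \<in> borel_measurable N" for f g :: "_ \<Rightarrow> real"
    using that by measurable
  show ?thesis
    unfolding below_run_def
    by (intro pred_intros_logic pred_intros_finite pred_rises_after less m X Y) auto
qed

lemma below_run_restrict:
  assumes "m \<le> n"
  shows "below_run m n y (restrict u {1..n}) \<longleftrightarrow> below_run m n y u"
proof -
  have "no_double_rise (restrict u {1..n}) m \<longleftrightarrow> no_double_rise u m"
    unfolding no_double_rise_def using assms by (intro ball_cong) auto
  moreover have "strict_mono_on {m<..n} (restrict u {1..n}) \<longleftrightarrow> strict_mono_on {m<..n} u"
    unfolding monotone_on_def by (intro ball_cong) auto
  ultimately show ?thesis
    unfolding below_run_def rises_after_def by auto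
qed

text \<open>The half-open interval matches the strict inequality between a run and its bound.\<close>

lemma nn_integral_power_Ico:
  fixes x c :: real
  assumes "0 \<le> x" "0 \<le> c"
  shows "(\<integral>\<^sup>+y. ennreal (c * y ^ k / fact k) * indicator {0..<x} y \<partial>lborel) =
         ennreal (c * x ^ Suc k / fact (Suc k))"
proof -
  have "(\<integral>\<^sup>+y. ennreal (c * y ^ k / fact k) * indicator {0..<x} y \<partial>lborel) =
        (\<integral>\<^sup>+y. ennreal (c * y ^ k / fact k) * indicator {0..x} y \<partial>lborel)"
    using AE_lborel_singleton[of x]
    by (intro nn_integral_cong_AE) (auto split: split_indicator elim!: eventually_mono)
  also have "\<dots> = ennreal (c * x ^ Suc k / fact (Suc k) - c * 0 ^ Suc k / fact (Suc k))"
  proof (rule nn_integral_FTC_Icc)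
    fix y
    have "c * (real (Suc k) * y ^ k) / fact (Suc k) = c * y ^ k / fact k"
      by (simp add: field_simps del: of_nat_Suc)
    moreover have "((\<lambda>y. c * y ^ Suc k / fact (Suc k)) has_real_derivative
              c * (real (Suc k) * y ^ k) / fact (Suc k)) (at y)"
      by (auto intro!: derivative_eq_intros simp del: power_Suc fact_Suc)
    ultimately show "((\<lambda>y. c * y ^ Suc k / fact (Suc k)) has_real_derivative c * y ^ k / fact k)
            (at y)"
      by simp
  qed (use assms in \<open>auto\<close>)
  finally show ?thesis by simp
qed

text \<open>
  Fubini for an independent pair, with the second variable evaluated at an independent outcome. Integrating over
  \<open>M\<close> leaves the choice of a convenient image measure of \<open>Y\<close> to the application.
\<close>

lemma (in prob_space) emeasure_indep_pair:
  assumes ind: "indep_var S X T Y" and A: "A \<in> sets (S \<Otimes>\<^sub>M T)"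
  shows "emeasure M {\<omega> \<in> space M. (X \<omega>, Y \<omega>) \<in> A} =
         (\<integral>\<^sup>+\<omega>'. emeasure M {\<omega> \<in> space M. (X \<omega>, Y \<omega>') \<in> A} \<partial>M)"
proof -
  have [measurable]: "X \<in> measurable M S" "Y \<in> measurable M T"
    and pair: "distr M S X \<Otimes>\<^sub>M distr M T Y = distr M (S \<Otimes>\<^sub>M T) (\<lambda>x. (X x, Y x))"
    using ind by (auto simp: indep_var_distribution_eq)
  interpret X: prob_space "distr M S X" by (rule prob_space_distr) fact
  interpret Y: prob_space "distr M T Y" by (rule prob_space_distr) fact
  interpret XY: pair_sigma_finite "distr M S X" "distr M T Y" ..
  have A': "A \<in> sets (distr M S X \<Otimes>\<^sub>M distr M T Y)" using A by simp
  have "emeasure M {\<omega> \<in> space M. (X \<omega>, Y \<omega>) \<in> A} = emeasure (distr M (S \<Otimes>\<^sub>M T) (\<lambda>x. (X x, Y x))) A"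
    using A by (subst emeasure_distr) (auto intro!: arg_cong2[where f=emeasure])
  also have "\<dots> = (\<integral>\<^sup>+y. emeasure (distr M S X) ((\<lambda>x. (x, y)) -` A) \<partial>distr M T Y)"
    unfolding pair[symmetric] by (rule XY.emeasure_pair_measure_alt2[OF A'])
  also have "\<dots> = (\<integral>\<^sup>+\<omega>'. emeasure (distr M S X) ((\<lambda>x. (x, Y \<omega>')) -` A) \<partial>M)"
    using XY.measurable_emeasure_Pair2[OF A']
    by (subst nn_integral_distr) auto
  also have "\<dots> = (\<integral>\<^sup>+\<omega>'. emeasure M {\<omega> \<in> space M. (X \<omega>, Y \<omega>') \<in> A} \<partial>M)"
  proof (rule nn_integral_cong)
    fix \<omega>'
    have "(\<lambda>x. (x, Y \<omega>')) -` A \<in> sets S" by (rule sets_Pair2[OF A])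
    then show "emeasure (distr M S X) ((\<lambda>x. (x, Y \<omega>')) -` A) = emeasure M {\<omega> \<in> space M. (X \<omega>, Y \<omega>') \<in> A}"
      by (subst emeasure_distr) (auto intro!: arg_cong2[where f=emeasure])
  qed
  finally show ?thesis .
qed

locale iid_uniform = prob_space M for M :: "'a measure" +
  fixes U :: "nat \<Rightarrow> 'a \<Rightarrow> real"
  assumes indep: "indep_vars (\<lambda>_. borel) U {1..}"
    and unif: "\<And>i. i \<ge> 1 \<Longrightarrow> distr M borel (U i) = uniform_measure lborel {0..1}"
begin

lemma measurable_U: "i \<ge> 1 \<Longrightarrow> U i \<in> borel_measurable M"
  using indep by (simp add: indep_vars_def)

lemma rises_after_event:
  assumes "m \<le> n"
  shows "{\<omega> \<in> space M. rises_after m (\<lambda>i. U i \<omega>) n} \<in> events"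
proof -
  have "Measurable.pred M (\<lambda>\<omega>. rises_after m (\<lambda>i. U i \<omega>) n)"
    by (intro pred_rises_after assms measurable_U) auto
  then show ?thesis by measurable
qed

text \<open>
  Conditioning on the last sample. The set \<open>B\<close> serves two purposes: \<open>{..<x}\<close> yields the recursion for bounded runs,
  and \<open>UNIV\<close> removes the bound at the end.
\<close>

lemma emeasure_run_step:
  assumes m: "m \<le> n" and B[measurable]: "B \<in> sets borel"
  shows "emeasure M {\<omega> \<in> space M. rises_after m (\<lambda>i. U i \<omega>) (Suc n) \<and> U (Suc n) \<omega> \<in> B} =
    (\<integral>\<^sup>+y. emeasure M {\<omega> \<in> space M. below_run m n y (\<lambda>i. U i \<omega>)} * indicator (B \<inter> {0..1}) y \<partial>lborel)"
proof -
  let ?S = "PiM {1..n} (\<lambda>_. borel) :: (nat \<Rightarrow> real) measure"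
  let ?X = "\<lambda>\<omega>. restrict (\<lambda>i. U i \<omega>) {1..n}"
  \<comment> \<open>Independence relates variables with values in one type, so the new sample is a family indexed by a singleton.\<close>
  let ?T = "PiM {Suc n} (\<lambda>_. borel) :: (nat \<Rightarrow> real) measure"
  let ?Y = "\<lambda>\<omega>. restrict (\<lambda>i. U i \<omega>) {Suc n}"
  let ?A = "{p \<in> space (?S \<Otimes>\<^sub>M ?T). below_run m n (snd p (Suc n)) (fst p) \<and> snd p (Suc n) \<in> B}"
  let ?g = "\<lambda>y. emeasure M {\<omega> \<in> space M. below_run m n y (\<lambda>i. U i \<omega>)}"
  have [measurable]: "Measurable.pred (?S \<Otimes>\<^sub>M ?T) (\<lambda>p. below_run m n (snd p (Suc n)) (fst p))"
    by (rule pred_below_run[OF m]) measurable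
  have A: "?A \<in> sets (?S \<Otimes>\<^sub>M ?T)" by measurable
  have mem: "(?X \<omega>, ?Y \<omega>') \<in> ?A \<longleftrightarrow> below_run m n (U (Suc n) \<omega>') (\<lambda>i. U i \<omega>) \<and> U (Suc n) \<omega>' \<in> B" for \<omega> \<omega>'
    using below_run_restrict[OF m] by (auto simp: space_pair_measure space_PiM)
  have XY: "indep_var ?S ?X ?T ?Y"
    by (rule indep_var_restrict[OF indep]) auto
  have [measurable]: "U (Suc n) \<in> borel_measurable M" by (rule measurable_U) simp
  have [measurable]: "?g \<in> borel_measurable borel"
  proof -
    have "Measurable.pred (borel \<Otimes>\<^sub>M M) (\<lambda>p. below_run m n (fst p) (\<lambda>i. U i (snd p)))"
      by (rule pred_below_run[OF m])
         (auto intro!: measurable_compose[OF measurable_snd measurable_U])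
    then have "{p \<in> space (borel \<Otimes>\<^sub>M M). below_run m n (fst p) (\<lambda>i. U i (snd p))} \<in> sets (borel \<Otimes>\<^sub>M M)"
      by measurable
    from measurable_emeasure_Pair[OF this]
    show ?thesis by (simp add: vimage_def space_pair_measure)
  qed
  have "emeasure M {\<omega> \<in> space M. rises_after m (\<lambda>i. U i \<omega>) (Suc n) \<and> U (Suc n) \<omega> \<in> B} =
        emeasure M {\<omega> \<in> space M. (?X \<omega>, ?Y \<omega>) \<in> ?A}"
    unfolding mem by (simp add: rises_after_Suc[OF m] below_run_def)
  also have "\<dots> = (\<integral>\<^sup>+\<omega>'. emeasure M {\<omega> \<in> space M. (?X \<omega>, ?Y \<omega>') \<in> ?A} \<partial>M)"
    by (rule emeasure_indep_pair[OF XY A])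
  also have "\<dots> = (\<integral>\<^sup>+\<omega>'. ?g (U (Suc n) \<omega>') * indicator B (U (Suc n) \<omega>') \<partial>M)"
    unfolding mem by (intro nn_integral_cong) (auto split: split_indicator)
  also have "\<dots> = (\<integral>\<^sup>+y. ?g y * indicator B y \<partial>distr M borel (U (Suc n)))"
    by (subst nn_integral_distr) auto
  also have "\<dots> = (\<integral>\<^sup>+y. ?g y * indicator B y \<partial>uniform_measure lborel {0..1})"
    by (simp add: unif)
  also have "\<dots> = (\<integral>\<^sup>+y. ?g y * indicator (B \<inter> {0..1}) y \<partial>lborel)"
    by (subst nn_integral_uniform_measure)
       (auto simp: indicator_inter_arith ac_simps divide_ennreal_def intro!: nn_integral_cong)
  finally show ?thesis .
qed

definition avoid_prob :: "nat \<Rightarrow> real" where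
  "avoid_prob n = prob {\<omega> \<in> space M. no_double_rise (\<lambda>i. U i \<omega>) n}"

text \<open>
  The bound enters as \<open>x ^ k / k!\<close>, since each further sample of the run amounts to integrating from \<open>0\<close> to \<open>x\<close>
  over its value.
\<close>

lemma emeasure_below_run:
  assumes "0 \<le> x" "x \<le> 1"
  shows "emeasure M {\<omega> \<in> space M. below_run m (m + k) x (\<lambda>i. U i \<omega>)} =
         ennreal (avoid_prob m * x ^ k / fact k)"
  using assms
proof (induction k arbitrary: x)
  case 0
  then show ?case
    by (simp add: below_run_def rises_after_refl avoid_prob_def emeasure_eq_measure)
next
  case (Suc k)
  have nonneg: "0 \<le> avoid_prob m" by (simp add: avoid_prob_def)
  have below: "below_run m (m + Suc k) x u \<longleftrightarrow>
      rises_after m u (Suc (m + k)) \<and> u (Suc (m + k)) \<in> {..<x}" for u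
  proof -
    have "{m<..m + Suc k} = insert (Suc (m + k)) {m<..m + k}" by auto
    then show ?thesis
      by (auto simp: below_run_def rises_after_Suc intro: less_trans)
  qed
  have "emeasure M {\<omega> \<in> space M. below_run m (m + Suc k) x (\<lambda>i. U i \<omega>)} =
    (\<integral>\<^sup>+y. emeasure M {\<omega> \<in> space M. below_run m (m + k) y (\<lambda>i. U i \<omega>)} *
       indicator ({..<x} \<inter> {0..1}) y \<partial>lborel)"
    unfolding below by (rule emeasure_run_step) auto
  also have "\<dots> = (\<integral>\<^sup>+y. ennreal (avoid_prob m * y ^ k / fact k) * indicator {0..<x} y \<partial>lborel)"
    using Suc.prems Suc.IH by (intro nn_integral_cong) (auto split: split_indicator)
  also have "\<dots> = ennreal (avoid_prob m * x ^ Suc k / fact (Suc k))"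
    by (rule nn_integral_power_Ico) (use Suc.prems nonneg in auto)
  finally show ?case .
qed

lemma prob_rises_after:
  assumes "m \<le> n"
  shows "prob {\<omega> \<in> space M. rises_after m (\<lambda>i. U i \<omega>) n} = avoid_prob m / fact (n - m)"
proof (cases "n = m")
  case True
  then show ?thesis by (simp add: rises_after_refl avoid_prob_def)
next
  case False
  then obtain k where n: "n = Suc (m + k)" using assms
    by (metis less_imp_Suc_add le_neq_implies_less)
  have nonneg: "0 \<le> avoid_prob m" by (simp add: avoid_prob_def)
  have "emeasure M {\<omega> \<in> space M. rises_after m (\<lambda>i. U i \<omega>) n} =
    (\<integral>\<^sup>+y. emeasure M {\<omega> \<in> space M. below_run m (m + k) y (\<lambda>i. U i \<omega>)} *
       indicator (UNIV \<inter> {0..1}) y \<partial>lborel)"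
    unfolding n by (subst emeasure_run_step[symmetric]) auto
  also have "\<dots> = (\<integral>\<^sup>+y. ennreal (avoid_prob m * y ^ k / fact k) * indicator {0..<1} y \<partial>lborel)"
    using AE_lborel_singleton[of "1::real"]
    by (intro nn_integral_cong_AE)
       (auto split: split_indicator elim!: eventually_mono simp: emeasure_below_run)
  also have "\<dots> = ennreal (avoid_prob m * 1 ^ Suc k / fact (Suc k))"
    by (rule nn_integral_power_Ico) (use nonneg in auto)
  finally show ?thesis
    using nonneg by (simp add: n measure_def Suc_diff_le)
qed

lemma avoid_prob_0: "avoid_prob 0 = 1"
  by (simp add: avoid_prob_def no_double_rise_def prob_space)

lemma avoid_prob_bounds: "0 \<le> avoid_prob n" "avoid_prob n \<le> 1"
  by (simp_all add: avoid_prob_def)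

text \<open>
  The expectation of the pointwise cancellation. Read as coefficients, it says that the exponential generating function
  of \<open>run_weight\<close> is the reciprocal of the generating function of \<open>avoid_prob\<close>.
\<close>

lemma avoid_prob_convolution:
  "(\<Sum>m\<le>n. avoid_prob m * (run_weight (n - m) / fact (n - m))) = of_bool (n = 0)"
proof (cases "n = 0")
  case True
  then show ?thesis by (simp add: avoid_prob_0)
next
  case False
  let ?E = "\<lambda>m. {\<omega> \<in> space M. rises_after m (\<lambda>i. U i \<omega>) n}"
  have ev: "?E m \<in> events" if "m \<le> n" for m
    using that by (rule rises_after_event)
  have "(\<Sum>m\<le>n. avoid_prob m * (run_weight (n - m) / fact (n - m))) = (\<Sum>m\<le>n. run_weight (n - m) * prob (?E m))"
    by (intro sum.cong) (auto simp: prob_rises_after)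
  also have "\<dots> = (\<Sum>m\<le>n. expectation (\<lambda>\<omega>. run_weight (n - m) * indicator (?E m) \<omega>))"
    by (intro sum.cong) (auto simp: ev)
  also have "\<dots> = expectation (\<lambda>\<omega>. \<Sum>m\<le>n. run_weight (n - m) * indicator (?E m) \<omega>)"
    by (intro Bochner_Integration.integral_sum[symmetric]) (auto simp: ev emeasure_eq_measure)
  also have "\<dots> = expectation (\<lambda>\<omega>. 0)"
  proof (intro Bochner_Integration.integral_cong refl)
    fix \<omega> assume "\<omega> \<in> space M"
    then have "(\<Sum>m\<le>n. run_weight (n - m) * indicator (?E m) \<omega>) =
               (\<Sum>m\<le>n. run_weight (n - m) * of_bool (rises_after m (\<lambda>i. U i \<omega>) n))"
      by (intro sum.cong) (auto simp: indicator_def)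
    also have "\<dots> = 0"
      using False by (intro final_run_cancellation) simp
    finally show "(\<Sum>m\<le>n. run_weight (n - m) * indicator (?E m) \<omega>) = 0" .
  qed
  finally show ?thesis using False by simp
qed

section \<open>From avoiding double rises to the waiting time\<close>

lemma waiting_time_eq_iff:
  "waiting_time U \<omega> = enat r \<longleftrightarrow>
     r \<ge> 1 \<and> no_double_rise (\<lambda>i. U i \<omega>) (r - 1) \<and> \<not> no_double_rise (\<lambda>i. U i \<omega>) r"
proof -
  define H where "H = {t. t \<ge> 3 \<and> U (t - 2) \<omega> < U (t - 1) \<omega> \<and> U (t - 1) \<omega> < U t \<omega>}"
  have W: "waiting_time U \<omega> = Inf (enat ` H)"
    by (simp add: waiting_time_def H_def)
  have no: "no_double_rise (\<lambda>i. U i \<omega>) n \<longleftrightarrow> (\<forall>t\<in>H. n < t)" for n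
    unfolding no_double_rise_def H_def by force
  have H0: "0 \<notin> H" by (simp add: H_def)
  have "waiting_time U \<omega> = enat r \<longleftrightarrow> r \<in> H \<and> (\<forall>t\<in>H. r \<le> t)"
  proof
    assume *: "waiting_time U \<omega> = enat r"
    then have "enat ` H \<noteq> {}" by (auto simp: W top_enat_def)
    then have "Inf (enat ` H) \<in> enat ` H"
      by (metis ex_in_conv Inf_enat_def LeastI)
    then have "r \<in> H" using * W by auto
    moreover have "r \<le> t" if "t \<in> H" for t
      using Inf_lower[of "enat t" "enat ` H"] that * W by simp
    ultimately show "r \<in> H \<and> (\<forall>t\<in>H. r \<le> t)" by blast
  next
    assume *: "r \<in> H \<and> (\<forall>t\<in>H. r \<le> t)"
    show "waiting_time U \<omega> = enat r"
      unfolding W using * by (intro Inf_eqI) auto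
  qed
  also have "\<dots> \<longleftrightarrow> r \<ge> 1 \<and> (\<forall>t\<in>H. r - 1 < t) \<and> \<not> (\<forall>t\<in>H. r < t)"
  proof (cases r)
    case 0
    then show ?thesis using H0 by auto
  next
    case (Suc k)
    show ?thesis unfolding Suc by (auto simp: Suc_le_eq) (metis not_less_eq less_SucE nat_neq_iff)+
  qed
  finally show ?thesis by (simp add: no)
qed

lemma prob_eq_waiting_time:
  "prob_eq M (waiting_time U) 0 = 0"
  "prob_eq M (waiting_time U) (Suc r) = avoid_prob r - avoid_prob (Suc r)"
proof -
  show "prob_eq M (waiting_time U) 0 = 0"
    by (simp add: prob_eq_def waiting_time_eq_iff)
  let ?G = "\<lambda>n. {\<omega> \<in> space M. no_double_rise (\<lambda>i. U i \<omega>) n}"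
  have ev: "?G n \<in> events" for n
    using rises_after_event[of n n] by (simp add: rises_after_refl)
  have "{\<omega> \<in> space M. waiting_time U \<omega> = enat (Suc r)} = ?G r - ?G (Suc r)"
    by (auto simp: waiting_time_eq_iff)
  moreover have "?G (Suc r) \<subseteq> ?G r" by (auto simp: no_double_rise_def)
  ultimately show "prob_eq M (waiting_time U) (Suc r) = avoid_prob r - avoid_prob (Suc r)"
    unfolding prob_eq_def avoid_prob_def by (simp add: finite_measure_Diff ev)
qed

end

section \<open>The generating functions\<close>

abbreviation (input) closed_form :: "real \<Rightarrow> real" where
  "closed_form x \<equiv> 1 + sqrt 3 / 2 * exp (x / 2) * (x - 1) * sec (pi / 6 + x * (sqrt 3 / 2))"

text \<open>
  With \<open>\<zeta> = exp (2 \<pi> \<i> / 3)\<close> and \<open>a = 2 / \<surd>3 \<cdot> exp (\<pi> \<i> / 6)\<close>, the sequence \<open>Re (a \<zeta>\<^sup>j)\<close> starts with \<open>1, - 1\<close>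
  and satisfies the recurrence of \<open>run_weight\<close>, because \<open>1 + \<zeta> + \<zeta>\<^sup>2 = 0\<close>. The series is thus the real part
  of \<open>a exp (\<zeta> x)\<close>.
\<close>

lemma run_weight_exp_sums:
  "(\<lambda>j. run_weight j / fact j * x ^ j) sums
     (2 / sqrt 3 * exp (- x / 2) * cos (pi / 6 + x * (sqrt 3 / 2)))"
proof -
  define \<zeta> where "\<zeta> = Complex (- 1 / 2) (sqrt 3 / 2)"
  define a where "a = Complex 1 (1 / sqrt 3)"
  have z2: "1 + \<zeta> + \<zeta>\<^sup>2 = 0"
    by (simp add: \<zeta>_def complex_eq_iff power2_eq_square)
  have Re_a: "Re (a * \<zeta> ^ j) = run_weight j" for j
  proof (induction j rule: induct_nat_012)
    case 0
    then show ?case by (simp add: a_def)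
  next
    case 1
    then show ?case by (simp add: a_def \<zeta>_def)
  next
    case (ge2 n)
    have "a * \<zeta> ^ n + a * \<zeta> ^ Suc n + a * \<zeta> ^ Suc (Suc n) = a * \<zeta> ^ n * (1 + \<zeta> + \<zeta>\<^sup>2)"
      by (simp add: algebra_simps power2_eq_square)
    then have "Re (a * \<zeta> ^ n) + Re (a * \<zeta> ^ Suc n) + Re (a * \<zeta> ^ Suc (Suc n)) = 0"
      unfolding z2 plus_complex.sel[symmetric] by simp
    then show ?case using ge2 run_weight_rec[of n] by linarith
  qed
  have "(\<lambda>j. a * ((\<zeta> * of_real x) ^ j /\<^sub>R fact j)) sums (a * exp (\<zeta> * of_real x))"
    by (intro sums_mult exp_converges)
  then have "(\<lambda>j. Re (a * ((\<zeta> * of_real x) ^ j /\<^sub>R fact j))) sums Re (a * exp (\<zeta> * of_real x))"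
    by (rule sums_Re)
  moreover have "Re (a * ((\<zeta> * of_real x) ^ j /\<^sub>R fact j)) = run_weight j / fact j * x ^ j" for j
  proof -
    have "a * ((\<zeta> * of_real x) ^ j /\<^sub>R fact j) = of_real (x ^ j / fact j) * (a * \<zeta> ^ j)"
      by (simp add: scaleR_conv_of_real power_mult_distrib field_simps)
    then have "Re (a * ((\<zeta> * of_real x) ^ j /\<^sub>R fact j)) = x ^ j / fact j * Re (a * \<zeta> ^ j)"
      by (simp only: scaleR_complex.sel flip: scaleR_conv_of_real)
    also have "\<dots> = run_weight j / fact j * x ^ j"
      unfolding Re_a by simp
    finally show ?thesis .
  qed
  moreover have "Re (a * exp (\<zeta> * of_real x)) =
      2 / sqrt 3 * exp (- x / 2) * cos (pi / 6 + x * (sqrt 3 / 2))"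
  proof -
    define t where "t = x * (sqrt 3 / 2)"
    have "exp (\<zeta> * of_real x) = of_real (exp (- x / 2)) * cis t"
      by (simp add: exp_eq_polar \<zeta>_def t_def mult.commute)
    then have "Re (a * exp (\<zeta> * of_real x)) = exp (- x / 2) * (cos t - sin t / sqrt 3)"
      by (simp add: a_def algebra_simps)
    also have "cos t - sin t / sqrt 3 = 2 / sqrt 3 * cos (pi / 6 + t)"
      by (simp only: cos_add cos_30 sin_30) (simp add: field_simps)
    finally show ?thesis by (simp add: t_def)
  qed
  ultimately show ?thesis by simp
qed

text \<open>The argument stays in \<open>(- \<pi> / 2, \<pi> / 2)\<close>, as \<open>\<surd>3 / 2 < 1 < \<pi> / 3\<close>.\<close>

lemma cos_pos:
  fixes x :: real assumes "\<bar>x\<bar> \<le> 1"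
  shows "cos (pi / 6 + x * (sqrt 3 / 2)) > 0"
proof -
  have "sqrt 3 \<le> 2" by (rule real_le_lsqrt) auto
  have "\<bar>x * (sqrt 3 / 2)\<bar> \<le> 1 * (2 / 2)"
    unfolding abs_mult using assms \<open>sqrt 3 \<le> 2\<close> by (intro mult_mono) auto
  then show ?thesis using pi_gt3 by (intro cos_gt_zero_pi) auto
qed

context iid_uniform
begin

lemma avoid_prob_summable:
  assumes "\<bar>x\<bar> < 1"
  shows "summable (\<lambda>n. norm (avoid_prob n * x ^ n))"
proof (rule summable_comparison_test')
  show "summable (\<lambda>n. \<bar>x\<bar> ^ n)" using assms by (intro summable_geometric) simp
  show "norm (norm (avoid_prob n * x ^ n)) \<le> \<bar>x\<bar> ^ n" for n
    using avoid_prob_bounds[of n] by (simp add: abs_mult power_abs mult_left_le_one_le)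
qed

lemma avoid_prob_sums:
  assumes "\<bar>x\<bar> < 1"
  shows "(\<lambda>n. avoid_prob n * x ^ n) sums (sqrt 3 / 2 * exp (x / 2) * sec (pi / 6 + x * (sqrt 3 / 2)))"
proof -
  have inv_unique: "A * G = 1 \<Longrightarrow> G * F = 1 \<Longrightarrow> A = F" for A G F :: real
    by (metis mult.assoc mult.right_neutral mult.left_neutral)
  let ?c = "\<lambda>j. run_weight j / fact j * x ^ j"
  have sc: "summable (\<lambda>j. norm (?c j))"
  proof (rule summable_comparison_test')
    show "summable (\<lambda>j. \<bar>x\<bar> ^ j /\<^sub>R fact j)" by (rule sums_summable[OF exp_converges])
    show "norm (norm (?c j)) \<le> \<bar>x\<bar> ^ j /\<^sub>R fact j" for j
      using abs_run_weight_le[of j]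
      by (simp add: abs_mult power_abs field_simps mult_left_le_one_le)
  qed
  have "(\<lambda>n. \<Sum>m\<le>n. (avoid_prob m * x ^ m) * ?c (n - m)) sums ((\<Sum>n. avoid_prob n * x ^ n) * (\<Sum>j. ?c j))"
    by (rule Cauchy_product_sums[OF avoid_prob_summable[OF assms] sc])
  moreover have "(\<Sum>m\<le>n. (avoid_prob m * x ^ m) * ?c (n - m)) = of_bool (n = 0)" for n
  proof -
    have "(\<Sum>m\<le>n. (avoid_prob m * x ^ m) * ?c (n - m)) =
          (\<Sum>m\<le>n. x ^ n * (avoid_prob m * (run_weight (n - m) / fact (n - m))))"
    proof (rule sum.cong)
      fix m assume "m \<in> {..n}"
      then have "x ^ n = x ^ m * x ^ (n - m)" by (simp flip: power_add)
      then show "(avoid_prob m * x ^ m) * ?c (n - m) = x ^ n * (avoid_prob m * (run_weight (n - m) / fact (n - m)))" by simp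
    qed simp
    also have "\<dots> = of_bool (n = 0)"
      unfolding sum_distrib_left[symmetric] avoid_prob_convolution by (cases n) simp_all
    finally show ?thesis .
  qed
  moreover have "(\<lambda>n::nat. of_bool (n = 0) :: real) sums 1"
    using sums_single[of 0 "\<lambda>_. 1::real"] by (simp add: of_bool_def)
  ultimately have "(\<Sum>n. avoid_prob n * x ^ n) * (\<Sum>j. ?c j) = 1"
    by (simp add: sums_unique2)
  moreover have "(\<Sum>j. ?c j) = 2 / sqrt 3 * exp (- x / 2) * cos (pi / 6 + x * (sqrt 3 / 2))"
    using run_weight_exp_sums by (rule sums_unique[symmetric])
  ultimately have "(\<Sum>n. avoid_prob n * x ^ n) * (2 / sqrt 3 * exp (- x / 2) * cos (pi / 6 + x * (sqrt 3 / 2))) = 1"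
    by (simp only:)
  moreover have "(2 / sqrt 3 * exp (- x / 2) * cos (pi / 6 + x * (sqrt 3 / 2))) *
      (sqrt 3 / 2 * exp (x / 2) * sec (pi / 6 + x * (sqrt 3 / 2))) = 1"
  proof -
    have "exp (- x / 2) * exp (x / 2) = 1" by (simp flip: exp_add)
    then show ?thesis using cos_pos[of x] assms by (simp add: sec_def)
  qed
  ultimately have "(\<Sum>n. avoid_prob n * x ^ n) = sqrt 3 / 2 * exp (x / 2) * sec (pi / 6 + x * (sqrt 3 / 2))"
    by (rule inv_unique)
  then show ?thesis
    using summable_sums[OF summable_norm_cancel[OF avoid_prob_summable[OF assms]]] by (simp only:)
qed

lemma pgf_interior:
  assumes "\<bar>x\<bar> < 1"
  shows "(\<lambda>r. prob_eq M (waiting_time U) r * x ^ r) sums closed_form x"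
proof -
  let ?Q = "sqrt 3 / 2 * exp (x / 2) * sec (pi / 6 + x * (sqrt 3 / 2))"
  have Q: "(\<lambda>n. avoid_prob n * x ^ n) sums ?Q" by (rule avoid_prob_sums[OF assms])
  then have "(\<lambda>n. avoid_prob (Suc n) * x ^ Suc n) sums (?Q - 1)"
    by (subst sums_Suc_iff) (simp add: avoid_prob_0)
  from sums_diff[OF sums_mult[OF Q, of x] this]
  have "(\<lambda>n. (avoid_prob n - avoid_prob (Suc n)) * x ^ Suc n) sums (x * ?Q - (?Q - 1))"
    by (simp add: algebra_simps)
  then have "(\<lambda>r. prob_eq M (waiting_time U) (Suc r) * x ^ Suc r) sums (x * ?Q - (?Q - 1))"
    by (simp only: prob_eq_waiting_time)
  then have "(\<lambda>r. prob_eq M (waiting_time U) r * x ^ r) sums (x * ?Q - (?Q - 1))"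
    by (subst (asm) sums_Suc_iff) (simp add: prob_eq_waiting_time)
  moreover have "x * ?Q - (?Q - 1) = closed_form x"
    by (simp add: field_simps)
  ultimately show ?thesis by (simp only:)
qed

lemma prob_eq_nonneg: "0 \<le> prob_eq M (waiting_time U) r"
  by (simp add: prob_eq_def)

lemma prob_eq_summable: "summable (prob_eq M (waiting_time U))"
proof (rule summableI_nonneg_bounded)
  fix n
  have "(\<Sum>r<Suc n. prob_eq M (waiting_time U) r) = 1 - avoid_prob n"
    by (induction n) (simp_all add: prob_eq_waiting_time avoid_prob_0)
  then show "(\<Sum>r<n. prob_eq M (waiting_time U) r) \<le> 1"
    using avoid_prob_bounds[of n] prob_eq_nonneg[of n] by simp
qed (rule prob_eq_nonneg)

text \<open>
  Both sides are continuous on \<open>[- 1, 1]\<close>, the left one as a uniform limit of its partial sums, so the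
  identity on the open interval carries over to the end points.
\<close>

lemma pgf_eq_closed_form:
  assumes "\<bar>x\<bar> \<le> 1"
  shows "pgf M (waiting_time U) x = closed_form x"
proof -
  let ?S = "{- 1..1::real}"
  have "uniform_limit ?S (\<lambda>n x. \<Sum>r<n. prob_eq M (waiting_time U) r * x ^ r)
          (pgf M (waiting_time U)) sequentially"
    unfolding pgf_def[abs_def]
  proof (rule Weierstrass_m_test[OF _ prob_eq_summable])
    show "norm (prob_eq M (waiting_time U) r * y ^ r) \<le> prob_eq M (waiting_time U) r"
      if "y \<in> ?S" for r y
      using that prob_eq_nonneg[of r]
      by (auto simp: abs_mult power_abs intro!: mult_left_le power_le_one)
  qed
  then have "continuous_on ?S (pgf M (waiting_time U))"
    by (rule uniform_limit_theorem[rotated]) (auto intro!: always_eventually continuous_intros)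
  moreover have "continuous_on ?S closed_form"
    unfolding sec_def
    by (intro continuous_intros) (auto simp del: times_divide_eq_right intro!: less_imp_neq[THEN not_sym] cos_pos)
  ultimately have "continuous_on (closure {- 1<..<1}) (\<lambda>x. pgf M (waiting_time U) x - closed_form x)"
    by (subst closure_greaterThanLessThan) (auto intro: continuous_on_diff)
  moreover have "pgf M (waiting_time U) y - closed_form y = 0" if "y \<in> {- 1<..<1}" for y
  proof -
    have "\<bar>y\<bar> < 1" using that by auto
    then show ?thesis
      unfolding pgf_def by (simp only: sums_unique[OF pgf_interior, symmetric] diff_self)
  qed
  ultimately have "pgf M (waiting_time U) x - closed_form x = 0"
    by (rule continuous_constant_on_closure) (use assms in auto)
  then show ?thesis by simp
qed

lemma closed_form_has_fps_expansion:
  "closed_form has_fps_expansion Abs_fps (prob_eq M (waiting_time U))"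
  unfolding has_fps_expansion_def
proof
  let ?F = "Abs_fps (prob_eq M (waiting_time U))"
  have "fps_conv_radius ?F \<ge> norm (1 :: real)"
    unfolding fps_conv_radius_def
    by (rule conv_radius_geI) (use prob_eq_summable in \<open>simp add: Abs_fps_inverse\<close>)
  then show "0 < fps_conv_radius ?F" by (auto intro: less_le_trans[rotated])
  have "\<forall>\<^sub>F x in nhds 0. x \<in> {- 1<..<1 :: real}"
    by (intro eventually_nhds_in_open) auto
  then show "\<forall>\<^sub>F x in nhds 0. eval_fps ?F x = closed_form x"
    by eventually_elim (use pgf_eq_closed_form in \<open>auto simp: eval_fps_def pgf_def\<close>)
qed

end

theorem theorem3p8:
  fixes M :: "'a measure" and U :: "nat \<Rightarrow> 'a \<Rightarrow> real"
  assumes "prob_space M"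
    and "prob_space.indep_vars M (\<lambda>_. borel) U {1..}"
    and "\<And>i. i \<ge> 1 \<Longrightarrow> distr M borel (U i) = uniform_measure lborel {0..1}"
  shows "(\<lambda>x::real. 1 + sqrt 3 / 2 * exp (x / 2) * (x - 1) * sec (pi / 6 + x * (sqrt 3 / 2)))
           has_fps_expansion Abs_fps (prob_eq M (waiting_time U)) \<and>
         (\<forall>x::real. \<bar>x\<bar> \<le> 1 \<longrightarrow>
            pgf M (waiting_time U) x =
              1 + sqrt 3 / 2 * exp (x / 2) * (x - 1) * sec (pi / 6 + x * (sqrt 3 / 2)))"
proof -
  interpret iid_uniform M U
    using assms by (intro iid_uniform.intro iid_uniform_axioms.intro)
  show ?thesis
    using closed_form_has_fps_expansion pgf_eq_closed_form by blast
qed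

end
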